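(* Let $\bar{x} = x/\|x\|_2$. Then the linear estimator $\widehat{x}_{\mathrm{lin}} = \frac1m\sum_{i=1}^m y_i a_i$ satisfies $$\mathbb{E}\, \widehat{x}_{\mathrm{lin}} = \mu \bar{x} \quad\text{and}\quad \mathbb{E}\, \|\widehat{x}_{\mathrm{lin}} - \mu \bar{x}\|_2^2 = \frac{1}{m}\Big[\sigma^2 + \eta^2 (n-1)\Big],$$ where $\mu = \mathbb{E}\, y_1\langle a_1,\bar{x}\rangle$, $\sigma^2 = \mathrm{Var}(y_1\langle a_1,\bar{x}\rangle)$ and $\eta^2 = \mathbb{E}\, y_1^2$.
   Context: Model (semiparametric single-index model): $x\in\mathbb{R}^n\setminus\{0\}$ is a fixed vector, $a_1,\dots,a_m$ are independent standard normal random vectors in $\mathbb{R}^n$, and $y_1,\dots,y_m$ are real-valued random variables such that the pairs $(a_i,y_i)$ are independent and identically distributed, and each $y_i$ depends on $a_i$ only through $\langle a_i,x\rangle$, i.e. given $\langle a_i,x\rangle$, $y_i$ and $a_i$ are conditionally independent. The quantities $\mu,\sigma^2,\eta^2$ are assumed well defined and finite. *)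

theory Defs
  imports "HOL-Probability.Probability"
begin

definition standard_normal_vector :: "'w measure \<Rightarrow> ('w \<Rightarrow> real ^ 'n) \<Rightarrow> bool" where
  "standard_normal_vector M g \<longleftrightarrow>
     prob_space.indep_vars M (\<lambda>_. borel) (\<lambda>j \<omega>. g \<omega> $ j) UNIV \<and>
     (\<forall>j. distributed M lborel (\<lambda>\<omega>. g \<omega> $ j) std_normal_density)"

(* X and Y are conditionally independent given Z. Conditioning on Z means conditioning on the
   sigma-algebra generated by Z, and the conditional probability of an event E is the
   conditional expectation of its indicator: P(X in A, Y in B | Z) = P(X in A | Z) P(Y in B | Z)
   almost surely, for all measurable A and B. *)
definition cond_indep_given ::
    "'w measure \<Rightarrow> 'u measure \<Rightarrow> ('w \<Rightarrow> 'u) \<Rightarrow> 's measure \<Rightarrow> ('w \<Rightarrow> 's) \<Rightarrow>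
     't measure \<Rightarrow> ('w \<Rightarrow> 't) \<Rightarrow> bool" where
  "cond_indep_given M U Z S X T Y \<longleftrightarrow>
     Z \<in> measurable M U \<and> X \<in> measurable M S \<and> Y \<in> measurable M T \<and>
     (\<forall>A \<in> sets S. \<forall>B \<in> sets T.
        AE \<omega> in M.
          real_cond_exp M (vimage_algebra (space M) Z U)
            (indicator ((X -` A \<inter> space M) \<inter> (Y -` B \<inter> space M))) \<omega> =
          real_cond_exp M (vimage_algebra (space M) Z U) (indicator (X -` A \<inter> space M)) \<omega> *
          real_cond_exp M (vimage_algebra (space M) Z U) (indicator (Y -` B \<inter> space M)) \<omega>)"

definition linear_estimator ::
    "nat \<Rightarrow> (nat \<Rightarrow> 'w \<Rightarrow> real ^ 'n) \<Rightarrow> (nat \<Rightarrow> 'w \<Rightarrow> real) \<Rightarrow> 'w \<Rightarrow> real ^ 'n" where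
  "linear_estimator m a y \<omega> = (1 / real m) *\<^sub>R (\<Sum>i = 1..m. y i \<omega> *\<^sub>R a i \<omega>)"

end

theory Submission
  imports Defs
begin

text \<open>
  Write \<open>X\<^sub>i = y\<^sub>i a\<^sub>i - \<mu> xbar\<close>, so that the estimator minus \<open>\<mu> xbar\<close> is the average of the
  independent and identically distributed vectors \<open>X\<^sub>i\<close>. Once they are known to be centered, their
  cross terms vanish and the mean square error is \<open>1/m\<close> times the mean of the squared norm of \<open>X\<^sub>1\<close> (\<open>norm_square_sum_indep_centered\<close>).
  Everything therefore reduces to the first two moments of a single vector \<open>y a\<close>.

  Split \<open>y a\<close> into its component \<open>y \<langle>a, xbar\<rangle>\<close> along \<open>xbar\<close>, which has mean \<open>\<mu>\<close> and variance \<open>\<sigma>\<^sup>2\<close> by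
  definition, and components \<open>y \<langle>a, v\<rangle>\<close> in directions \<open>v\<close> orthogonal to \<open>x\<close>. For a Gaussian vector,
  \<open>\<langle>a, v\<rangle>\<close> is independent of \<open>\<langle>a, x\<rangle>\<close> (\<open>standard_normal_vector_orthogonal_indep\<close>). Since \<open>y\<close> depends on
  \<open>a\<close> only through \<open>\<langle>a, x\<rangle>\<close>, it is then independent of \<open>\<langle>a, v\<rangle>\<close> outright (\<open>cond_indep_given_indep\<close>),
  whence \<open>y \<langle>a, v\<rangle>\<close> has mean \<open>0\<close> and second moment \<open>\<eta>\<^sup>2 |v|\<^sup>2\<close>. The \<open>n - 1\<close> orthogonal dimensions
  contribute \<open>\<eta>\<^sup>2 (n - 1)\<close> altogether (\<open>single_index_moments\<close>).

  The Gaussian independence is obtained from characteristic functions: two real random variables whose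
  joint characteristic function factorizes are independent (\<open>indep_var_if_char_factorizes\<close>), which is
  derived here from the one-dimensional uniqueness theorem of Levy, applied to each variable in turn.
\<close>

section \<open>Independence from a factorizing characteristic function\<close>

text \<open>
  The events generated by a random variable are exactly its preimages of measurable sets, and these
  are closed under intersection; so checking products of probabilities on them is enough.
\<close>
lemma (in prob_space) indep_varI_prob:
  assumes X: "random_variable S X" and Y: "random_variable T Y"
    and eq: "\<And>A B. A \<in> sets S \<Longrightarrow> B \<in> sets T \<Longrightarrow>
      prob ((X -` A \<inter> space M) \<inter> (Y -` B \<inter> space M)) =
      prob (X -` A \<inter> space M) * prob (Y -` B \<inter> space M)"
  shows "indep_var S X T Y"
  unfolding indep_var_eq
proof (intro conjI indep_set_sigma_sets X Y)
  show "indep_set {X -` A \<inter> space M |A. A \<in> sets S} {Y -` B \<inter> space M |B. B \<in> sets T}"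
    using X Y eq by (intro indep_setI) (auto intro: measurable_sets)
  show "Int_stable {X -` A \<inter> space M |A. A \<in> sets S}"
    by (rule Int_stableI) (safe, metis (no_types) Int_assoc inf_left_idem inf_commute sets.Int vimage_Int)
  show "Int_stable {Y -` B \<inter> space M |B. B \<in> sets T}"
    by (rule Int_stableI) (safe, metis (no_types) Int_assoc inf_left_idem inf_commute sets.Int vimage_Int)
qed

lemma (in prob_space) expectation_indicator_vimage:
  assumes [measurable]: "random_variable N X" "B \<in> sets N"
  shows "expectation (\<lambda>\<omega>. indicator B (X \<omega>) :: real) = prob (X -` B \<inter> space M)"
proof -
  have "expectation (\<lambda>\<omega>. indicator B (X \<omega>) :: real) =
        expectation (indicator (X -` B \<inter> space M))"
    by (intro Bochner_Integration.integral_cong) (auto simp: indicator_def)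
  then show ?thesis by simp
qed

text \<open>
  After normalization, a nonnegative weight \<open>W\<close> is a density of a second probability measure. The hypothesis
  says that \<open>X\<close> has the same characteristic function under both measures, so by uniqueness it has the
  same law under both.
\<close>
lemma (in prob_space) weight_decouples_if_char:
  fixes X W :: "'a \<Rightarrow> real"
  assumes X[measurable]: "random_variable borel X"
    and W[measurable]: "random_variable borel W"
    and bounds: "\<And>\<omega>. 0 \<le> W \<omega>" "\<And>\<omega>. W \<omega> \<le> C"
    and eq: "\<And>t. (CLINT \<omega>|M. W \<omega> *\<^sub>R iexp (t * X \<omega>)) =
               expectation W *\<^sub>R char (distr M borel X) t"
    and B[measurable]: "B \<in> sets borel"
  shows "expectation (\<lambda>\<omega>. W \<omega> * indicator B (X \<omega>)) =
         expectation W * prob (X -` B \<inter> space M)"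
proof -
  have int_W: "integrable M W"
    by (rule integrable_const_bound[of _ C]) (use bounds in auto)
  show ?thesis
  \<comment> \<open>If the weight has mean zero, it vanishes almost surely and cannot be normalized.\<close>
  proof (cases "expectation W = 0")
    case True
    then have "AE \<omega> in M. W \<omega> = 0"
      using integral_nonneg_eq_0_iff_AE[OF int_W] bounds by simp
    then have "expectation (\<lambda>\<omega>. W \<omega> * indicator B (X \<omega>)) = expectation (\<lambda>_. 0)"
      by (intro integral_cong_AE) auto
    then show ?thesis using True by simp
  next
    case False
    define c where "c = expectation W"
    have c: "c > 0"
      using False integral_nonneg_AE[of W M] bounds unfolding c_def by (simp add: less_le)
    define N where "N = density M (\<lambda>\<omega>. ennreal (W \<omega> / c))"
    have [simp, measurable_cong]: "sets N = sets M" and [simp]: "space N = space M"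
      by (auto simp: N_def)
    have "emeasure N (space N) = (\<integral>\<^sup>+ \<omega>. ennreal (W \<omega> / c) \<partial>M)"
      unfolding N_def by (subst emeasure_density) (auto intro!: nn_integral_cong)
    also have "\<dots> = ennreal (expectation (\<lambda>\<omega>. W \<omega> / c))"
      by (rule nn_integral_eq_integral) (use int_W c bounds in auto)
    also have "expectation (\<lambda>\<omega>. W \<omega> / c) = 1"
      using c by (simp add: c_def)
    finally interpret N: prob_space N
      by (intro prob_spaceI) simp
    have "char (distr N borel X) t = char (distr M borel X) t" for t
    proof -
      have "char (distr N borel X) t = (CLINT \<omega>|N. iexp (t * X \<omega>))"
        by (simp add: char_def integral_distr)
      also have "\<dots> = (CLINT \<omega>|M. (W \<omega> / c) *\<^sub>R iexp (t * X \<omega>))"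
        unfolding N_def by (rule integral_density) (use bounds c in auto)
      also have "\<dots> = (CLINT \<omega>|M. (1 / c) *\<^sub>R (W \<omega> *\<^sub>R iexp (t * X \<omega>)))"
        by simp
      also have "\<dots> = (1 / c) *\<^sub>R (CLINT \<omega>|M. W \<omega> *\<^sub>R iexp (t * X \<omega>))"
        by (rule integral_scaleR_right)
      also have "\<dots> = char (distr M borel X) t"
        using c by (simp only: eq) (simp add: c_def)
      finally show ?thesis .
    qed
    then have "distr N borel X = distr M borel X"
      by (intro Levy_uniqueness) auto
    then have "measure (distr N borel X) B = measure (distr M borel X) B"
      by simp
    then have "measure N (X -` B \<inter> space M) = prob (X -` B \<inter> space M)"
      by (simp add: measure_distr)
    moreover have "measure N (X -` B \<inter> space M) = (LINT \<omega>|N. indicator B (X \<omega>))"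
      by (subst N.expectation_indicator_vimage[where N = borel]) auto
    moreover have "\<dots> = (LINT \<omega>|M. (W \<omega> / c) *\<^sub>R indicator B (X \<omega>))"
      unfolding N_def by (rule integral_density) (use bounds c in auto)
    moreover have "\<dots> = (LINT \<omega>|M. W \<omega> * indicator B (X \<omega>)) / c"
      by simp
    ultimately show ?thesis
      using c by (simp add: c_def field_simps)
  qed
qed

text \<open>
  Hypothesis and conclusion are linear in \<open>W\<close> and true of constant weights, so the bound \<open>C\<close> may be
  added to \<open>W\<close> to make it nonnegative.
\<close>
lemma (in prob_space) bounded_decouples_if_char:
  fixes X W :: "'a \<Rightarrow> real"
  assumes X[measurable]: "random_variable borel X"
    and W[measurable]: "random_variable borel W"
    and bound: "\<And>\<omega>. \<bar>W \<omega>\<bar> \<le> C"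
    and eq: "\<And>t. (CLINT \<omega>|M. W \<omega> *\<^sub>R iexp (t * X \<omega>)) =
               expectation W *\<^sub>R char (distr M borel X) t"
    and B[measurable]: "B \<in> sets borel"
  shows "expectation (\<lambda>\<omega>. W \<omega> * indicator B (X \<omega>)) =
         expectation W * prob (X -` B \<inter> space M)"
proof -
  have int_W: "integrable M W"
    by (rule integrable_const_bound[of _ C]) (use bound in auto)
  have int_e: "integrable M (\<lambda>\<omega>. iexp (t * X \<omega>))" for t
    using integrable_iexp[of "\<lambda>\<omega>. complex_of_real (t * X \<omega>)"] by simp
  have int_We: "integrable M (\<lambda>\<omega>. W \<omega> *\<^sub>R iexp (t * X \<omega>))" for t
    by (rule Bochner_Integration.integrable_bound[OF int_W]) auto
  have int_ind: "integrable M (\<lambda>\<omega>. indicator B (X \<omega>) :: real)"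
    by (rule integrable_const_bound[of _ 1]) auto
  have int_Wind: "integrable M (\<lambda>\<omega>. W \<omega> * indicator B (X \<omega>))"
    by (rule Bochner_Integration.integrable_bound[OF int_W]) (auto simp: indicator_def)
  have prob_ind: "expectation (\<lambda>\<omega>. indicator B (X \<omega>)) = prob (X -` B \<inter> space M)"
    by (rule expectation_indicator_vimage[where N = borel]) simp_all
  have "expectation (\<lambda>\<omega>. (W \<omega> + C) * indicator B (X \<omega>)) =
        expectation (\<lambda>\<omega>. W \<omega> + C) * prob (X -` B \<inter> space M)"
  proof (rule weight_decouples_if_char[OF X _ _ _ _ B])
    show "0 \<le> W \<omega> + C" "W \<omega> + C \<le> 2 * C" for \<omega>
      using bound[of \<omega>] by auto
    fix t
    have "(CLINT \<omega>|M. (W \<omega> + C) *\<^sub>R iexp (t * X \<omega>)) =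
        (CLINT \<omega>|M. W \<omega> *\<^sub>R iexp (t * X \<omega>)) + (CLINT \<omega>|M. C *\<^sub>R iexp (t * X \<omega>))"
      unfolding scaleR_add_left
      by (rule Bochner_Integration.integral_add) (use int_We int_e in auto)
    also have "(CLINT \<omega>|M. C *\<^sub>R iexp (t * X \<omega>)) = C *\<^sub>R char (distr M borel X) t"
      by (subst integral_scaleR_right) (simp_all add: int_e char_def integral_distr)
    finally show "(CLINT \<omega>|M. (W \<omega> + C) *\<^sub>R iexp (t * X \<omega>)) =
        expectation (\<lambda>\<omega>. W \<omega> + C) *\<^sub>R char (distr M borel X) t"
      using int_W by (simp only: eq) (simp add: prob_space algebra_simps)
  qed simp
  then show ?thesis
    using int_W int_ind int_Wind by (simp add: distrib_right prob_ind prob_space)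
qed

text \<open>
  Kac's theorem. The weights \<open>cos (t Y)\<close> and \<open>sin (t Y)\<close> are combinations of \<open>iexp (\<plusminus> t Y)\<close>, so by
  factorization they decouple from the characters of \<open>X\<close>, hence from every event \<open>X \<in> A\<close>. Read
  the other way round, the weight \<open>indicator A X\<close> decouples from the characters of \<open>Y\<close>, hence from every
  event \<open>Y \<in> B\<close>.
\<close>
lemma (in prob_space) indep_var_if_char_factorizes:
  fixes X Y :: "'a \<Rightarrow> real"
  assumes X[measurable]: "random_variable borel X"
    and Y[measurable]: "random_variable borel Y"
    and factor: "\<And>s t. (CLINT \<omega>|M. iexp (s * X \<omega> + t * Y \<omega>)) =
               char (distr M borel X) s * char (distr M borel Y) t"
  shows "indep_var borel X borel Y"
proof (rule indep_varI_prob[OF X Y])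
  fix A B :: "real set"
  assume [measurable]: "A \<in> sets borel" "B \<in> sets borel"
  have int_iexp: "integrable M (\<lambda>\<omega>. iexp (Z \<omega>))"
    if [measurable]: "Z \<in> borel_measurable M" for Z :: "'a \<Rightarrow> real"
    using integrable_iexp[of "\<lambda>\<omega>. complex_of_real (Z \<omega>)"] by simp
  have char_distr: "char (distr M borel Z) t = (CLINT \<omega>|M. iexp (t * Z \<omega>))"
    if [measurable]: "Z \<in> borel_measurable M" for Z :: "'a \<Rightarrow> real" and t
    by (simp add: char_def integral_distr)
  have int_A: "integrable M (\<lambda>\<omega>. indicator A (X \<omega>) :: real)"
    by (rule integrable_const_bound[of _ 1]) auto
  have cos_eq: "cos r *\<^sub>R iexp q = (iexp (q + r) + iexp (q + - r)) * (1 / 2)"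
    and sin_eq: "sin r *\<^sub>R iexp q = (iexp (q + r) - iexp (q + - r)) * (- \<i> / 2)" for q r :: real
    by (simp_all add: Re_exp Im_exp complex_eq_iff cos_add sin_add cos_diff sin_diff
        field_simps)
  have cosX: "(CLINT \<omega>|M. cos (t * Y \<omega>) *\<^sub>R iexp (s * X \<omega>)) =
      (char (distr M borel Y) t + char (distr M borel Y) (- t)) * (1 / 2) * char (distr M borel X) s"
    and sinX: "(CLINT \<omega>|M. sin (t * Y \<omega>) *\<^sub>R iexp (s * X \<omega>)) =
      (char (distr M borel Y) t - char (distr M borel Y) (- t)) * (- \<i> / 2) * char (distr M borel X) s"
    for s t
  proof -
    have e1: "integrable M (\<lambda>\<omega>. iexp (s * X \<omega> + t * Y \<omega>))"
      and e2: "integrable M (\<lambda>\<omega>. iexp (s * X \<omega> + - (t * Y \<omega>)))"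
      by (rule int_iexp; simp)+
    have f2: "(CLINT \<omega>|M. iexp (s * X \<omega> + - (t * Y \<omega>))) =
        char (distr M borel X) s * char (distr M borel Y) (- t)"
      using factor[of s "- t"] by (simp only: mult_minus_left)
    show "(CLINT \<omega>|M. cos (t * Y \<omega>) *\<^sub>R iexp (s * X \<omega>)) =
        (char (distr M borel Y) t + char (distr M borel Y) (- t)) * (1 / 2) * char (distr M borel X) s"
      unfolding cos_eq integral_mult_left_zero Bochner_Integration.integral_add[OF e1 e2] factor f2
      by (simp add: algebra_simps)
    show "(CLINT \<omega>|M. sin (t * Y \<omega>) *\<^sub>R iexp (s * X \<omega>)) =
        (char (distr M borel Y) t - char (distr M borel Y) (- t)) * (- \<i> / 2) * char (distr M borel X) s"
      unfolding sin_eq integral_mult_left_zero Bochner_Integration.integral_diff[OF e1 e2] factor f2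
      by (simp add: algebra_simps)
  qed
  \<comment> \<open>The case \<open>s = 0\<close> gives the means of the weights themselves.\<close>
  have cosE: "complex_of_real (expectation (\<lambda>\<omega>. cos (t * Y \<omega>))) =
      (char (distr M borel Y) t + char (distr M borel Y) (- t)) * (1 / 2)"
   and sinE: "complex_of_real (expectation (\<lambda>\<omega>. sin (t * Y \<omega>))) =
      (char (distr M borel Y) t - char (distr M borel Y) (- t)) * (- \<i> / 2)" for t
    using cosX[of t 0] sinX[of t 0]
    by (simp_all add: char_distr prob_space scaleR_conv_of_real)
  have cosA: "expectation (\<lambda>\<omega>. cos (t * Y \<omega>) * indicator A (X \<omega>)) =
      expectation (\<lambda>\<omega>. cos (t * Y \<omega>)) * prob (X -` A \<inter> space M)"
   and sinA: "expectation (\<lambda>\<omega>. sin (t * Y \<omega>) * indicator A (X \<omega>)) =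
      expectation (\<lambda>\<omega>. sin (t * Y \<omega>)) * prob (X -` A \<inter> space M)" for t
    by (intro bounded_decouples_if_char[where C = 1]; (unfold cosX sinX)?;
        (unfold scaleR_conv_of_real cosE sinE)?; simp)+
  have PA: "expectation (\<lambda>\<omega>. indicator A (X \<omega>)) = prob (X -` A \<inter> space M)"
    by (rule expectation_indicator_vimage[where N = borel]) simp_all
  have "expectation (\<lambda>\<omega>. indicator A (X \<omega>) * indicator B (Y \<omega>)) =
      expectation (\<lambda>\<omega>. indicator A (X \<omega>)) * prob (Y -` B \<inter> space M)"
  proof (rule bounded_decouples_if_char[where C = 1])
    fix t
    have "(CLINT \<omega>|M. indicator A (X \<omega>) *\<^sub>R iexp (t * Y \<omega>)) =
        (CLINT \<omega>|M. complex_of_real (cos (t * Y \<omega>) * indicator A (X \<omega>)) +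
                    \<i> * complex_of_real (sin (t * Y \<omega>) * indicator A (X \<omega>)))"
      by (intro Bochner_Integration.integral_cong)
         (auto simp: complex_eq_iff Re_exp Im_exp)
    also have "\<dots> = expectation (\<lambda>\<omega>. cos (t * Y \<omega>) * indicator A (X \<omega>)) +
        \<i> * expectation (\<lambda>\<omega>. sin (t * Y \<omega>) * indicator A (X \<omega>))"
      by (subst Bochner_Integration.integral_add)
         (auto intro!: Bochner_Integration.integrable_bound[OF int_A] integrable_mult_right
           simp: abs_mult indicator_def
           simp flip: of_real_mult)
    also have "\<dots> = prob (X -` A \<inter> space M) *\<^sub>R char (distr M borel Y) t"
      unfolding cosA sinA by (simp add: cosE sinE scaleR_conv_of_real algebra_simps)
    finally show "(CLINT \<omega>|M. indicator A (X \<omega>) *\<^sub>R iexp (t * Y \<omega>)) =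
        expectation (\<lambda>\<omega>. indicator A (X \<omega>)) *\<^sub>R char (distr M borel Y) t"
      by (simp add: PA)
  qed (auto simp: indicator_def)
  moreover have "expectation (\<lambda>\<omega>. indicator A (X \<omega>) * indicator B (Y \<omega>)) =
      prob ((X -` A \<inter> space M) \<inter> (Y -` B \<inter> space M))"
    using expectation_indicator_vimage[of "\<lambda>\<omega>. (X \<omega>, Y \<omega>)" "borel \<Otimes>\<^sub>M borel" "A \<times> B"]
    by (auto simp: indicator_times intro!: arg_cong[where f = prob])
  ultimately show "prob ((X -` A \<inter> space M) \<inter> (Y -` B \<inter> space M)) =
      prob (X -` A \<inter> space M) * prob (Y -` B \<inter> space M)"
    by (simp add: PA)
qed

section \<open>Second moments of sums of independent centered variables\<close>

text \<open>
  Each summand is independent of the sum of the others, so the mean of their product is the product of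
  their means, which is \<open>0\<close>.
\<close>
lemma (in prob_space) square_sum_indep_centered:
  fixes X :: "'i \<Rightarrow> 'a \<Rightarrow> real"
  assumes fin: "finite I"
    and indep: "indep_vars (\<lambda>_. borel) X I"
    and sq: "\<And>i. i \<in> I \<Longrightarrow> integrable M (\<lambda>\<omega>. (X i \<omega>)\<^sup>2)"
    and centered: "\<And>i. i \<in> I \<Longrightarrow> expectation (X i) = 0"
  shows "integrable M (\<lambda>\<omega>. (\<Sum>i\<in>I. X i \<omega>)\<^sup>2)"
    and "expectation (\<lambda>\<omega>. (\<Sum>i\<in>I. X i \<omega>)\<^sup>2) = (\<Sum>i\<in>I. expectation (\<lambda>\<omega>. (X i \<omega>)\<^sup>2))"
proof -
  have rv: "random_variable borel (X i)" if "i \<in> I" for i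
    using indep that by (auto simp: indep_vars_def)
  have int: "integrable M (X i)" if "i \<in> I" for i
    using square_integrable_imp_integrable[OF rv[OF that]] sq[OF that] by simp
  have "integrable M (\<lambda>\<omega>. (\<Sum>i\<in>J. X i \<omega>)\<^sup>2) \<and>
    expectation (\<lambda>\<omega>. (\<Sum>i\<in>J. X i \<omega>)\<^sup>2) = (\<Sum>i\<in>J. expectation (\<lambda>\<omega>. (X i \<omega>)\<^sup>2))"
    if "J \<subseteq> I" for J
    using finite_subset[OF that fin] that
  proof (induction J rule: finite_induct)
    case (insert i J)
    let ?S = "\<lambda>\<omega>. \<Sum>j\<in>J. X j \<omega>"
    have iv: "indep_var borel (X i) borel ?S"
      using insert by (intro indep_vars_sum indep_vars_subset[OF indep]) auto
    have i: "integrable M (X i)" "integrable M ?S"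
      using insert int by auto
    have cross: "integrable M (\<lambda>\<omega>. X i \<omega> * ?S \<omega>)" "expectation (\<lambda>\<omega>. X i \<omega> * ?S \<omega>) = 0"
      using indep_var_integrable[OF iv i] indep_var_lebesgue_integral[OF iv i] centered insert
      by auto
    have "(\<lambda>\<omega>. (\<Sum>j\<in>insert i J. X j \<omega>)\<^sup>2) =
        (\<lambda>\<omega>. (X i \<omega>)\<^sup>2 + (?S \<omega>)\<^sup>2 + 2 * (X i \<omega> * ?S \<omega>))"
      using insert by (auto simp: power2_sum)
    then show ?case
      using insert cross sq by simp
  qed simp
  from this[of I] show "integrable M (\<lambda>\<omega>. (\<Sum>i\<in>I. X i \<omega>)\<^sup>2)"
    and "expectation (\<lambda>\<omega>. (\<Sum>i\<in>I. X i \<omega>)\<^sup>2) = (\<Sum>i\<in>I. expectation (\<lambda>\<omega>. (X i \<omega>)\<^sup>2))"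
    by auto
qed

text \<open>
  The scalar case, summed over the coordinates of an orthonormal basis.
\<close>
lemma (in prob_space) norm_square_sum_indep_centered:
  fixes X :: "'i \<Rightarrow> 'a \<Rightarrow> 'b::euclidean_space"
  assumes fin: "finite I"
    and indep: "indep_vars (\<lambda>_. borel) X I"
    and sq: "\<And>i. i \<in> I \<Longrightarrow> integrable M (\<lambda>\<omega>. (norm (X i \<omega>))\<^sup>2)"
    and int: "\<And>i. i \<in> I \<Longrightarrow> integrable M (X i)"
    and centered: "\<And>i. i \<in> I \<Longrightarrow> expectation (X i) = 0"
  shows "integrable M (\<lambda>\<omega>. (norm (\<Sum>i\<in>I. X i \<omega>))\<^sup>2)"
    and "expectation (\<lambda>\<omega>. (norm (\<Sum>i\<in>I. X i \<omega>))\<^sup>2) =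
      (\<Sum>i\<in>I. expectation (\<lambda>\<omega>. (norm (X i \<omega>))\<^sup>2))"
proof -
  have norm_sq: "(norm z)\<^sup>2 = (\<Sum>b\<in>Basis. (z \<bullet> b)\<^sup>2)" for z :: 'b
    by (subst power2_norm_eq_inner, subst euclidean_inner) (simp add: power2_eq_square)
  have rv[measurable]: "random_variable borel (X i)" if "i \<in> I" for i
    using indep that by (auto simp: indep_vars_def)
  have sq_b: "integrable M (\<lambda>\<omega>. (X i \<omega> \<bullet> b)\<^sup>2)" if "i \<in> I" "b \<in> Basis" for i b
  proof (rule Bochner_Integration.integrable_bound[OF sq[OF that(1)]])
    show "(\<lambda>\<omega>. (X i \<omega> \<bullet> b)\<^sup>2) \<in> borel_measurable M"
      using rv[OF that(1)] by measurable
    show "AE \<omega> in M. norm ((X i \<omega> \<bullet> b)\<^sup>2) \<le> norm ((norm (X i \<omega>))\<^sup>2)"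
      using power_mono[OF Basis_le_norm[OF that(2)], of _ 2] by simp
  qed
  have coord: "integrable M (\<lambda>\<omega>. (\<Sum>i\<in>I. X i \<omega> \<bullet> b)\<^sup>2)"
    "expectation (\<lambda>\<omega>. (\<Sum>i\<in>I. X i \<omega> \<bullet> b)\<^sup>2) = (\<Sum>i\<in>I. expectation (\<lambda>\<omega>. (X i \<omega> \<bullet> b)\<^sup>2))"
    if b: "b \<in> Basis" for b
  proof -
    have "indep_vars (\<lambda>_. borel) (\<lambda>i \<omega>. X i \<omega> \<bullet> b) I"
      by (rule indep_vars_compose2[OF indep]) simp
    moreover have "expectation (\<lambda>\<omega>. X i \<omega> \<bullet> b) = 0" if "i \<in> I" for i
      using centered[OF that] int[OF that] by simp
    ultimately show "integrable M (\<lambda>\<omega>. (\<Sum>i\<in>I. X i \<omega> \<bullet> b)\<^sup>2)"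
      "expectation (\<lambda>\<omega>. (\<Sum>i\<in>I. X i \<omega> \<bullet> b)\<^sup>2) = (\<Sum>i\<in>I. expectation (\<lambda>\<omega>. (X i \<omega> \<bullet> b)\<^sup>2))"
      using square_sum_indep_centered[OF fin, of "\<lambda>i \<omega>. X i \<omega> \<bullet> b"] sq_b b by auto
  qed
  show "integrable M (\<lambda>\<omega>. (norm (\<Sum>i\<in>I. X i \<omega>))\<^sup>2)"
    unfolding norm_sq inner_sum_left using coord by simp
  show "expectation (\<lambda>\<omega>. (norm (\<Sum>i\<in>I. X i \<omega>))\<^sup>2) =
      (\<Sum>i\<in>I. expectation (\<lambda>\<omega>. (norm (X i \<omega>))\<^sup>2))"
    unfolding norm_sq inner_sum_left using coord sq_b
    by (simp add: sum.swap[of _ Basis])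
qed

section \<open>Projections of a standard normal vector\<close>

lemma standard_normal_vector_measurable:
  assumes "standard_normal_vector M g"
  shows standard_normal_vector_coord_measurable: "(\<lambda>\<omega>. g \<omega> $ j) \<in> borel_measurable M"
    and standard_normal_vector_borel_measurable: "g \<in> borel_measurable M"
proof -
  have coord: "(\<lambda>\<omega>. g \<omega> $ j) \<in> borel_measurable M" for j
    using assms distributed_measurable[of M lborel "\<lambda>\<omega>. g \<omega> $ j"]
    by (auto simp: standard_normal_vector_def)
  then show "(\<lambda>\<omega>. g \<omega> $ j) \<in> borel_measurable M" .
  from coord show "g \<in> borel_measurable M"
    by (subst borel_measurable_euclidean_space) (auto simp: Basis_vec_def inner_axis)
qed

lemma (in prob_space) standard_normal_vector_weighted_indep:
  fixes g :: "'a \<Rightarrow> real ^ 'n"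
  assumes "standard_normal_vector M g"
  shows "indep_vars (\<lambda>_. borel) (\<lambda>j \<omega>. w $ j * g \<omega> $ j) UNIV"
  using assms indep_vars_compose2[of "\<lambda>_. borel" "\<lambda>j \<omega>. g \<omega> $ j" UNIV "\<lambda>j r. w $ j * r" "\<lambda>_. borel"]
  by (simp add: standard_normal_vector_def)

text \<open>
  The projection \<open>\<langle>g, w\<rangle>\<close> is a sum of independent variables \<open>w\<^sub>j g\<^sub>j\<close>, whose characteristic functions
  multiply; all of them are evaluated at \<open>1\<close>.
\<close>
lemma (in prob_space) standard_normal_vector_char:
  fixes g :: "'a \<Rightarrow> real ^ 'n"
  assumes g: "standard_normal_vector M g"
  shows "(CLINT \<omega>|M. iexp (g \<omega> \<bullet> w)) = exp (- (norm w)\<^sup>2 / 2)"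
proof -
  note [measurable] = standard_normal_vector_measurable[OF g]
  have coord: "(CLINT \<omega>|M. iexp (w $ j * g \<omega> $ j)) = complex_of_real (exp (- (w $ j)\<^sup>2 / 2))" for j
  proof -
    have "distributed M lborel (\<lambda>\<omega>. g \<omega> $ j) std_normal_density"
      using g by (simp add: standard_normal_vector_def)
    then have "distr M lborel (\<lambda>\<omega>. g \<omega> $ j) = std_normal_distribution"
      by (rule distributed_distr_eq_density)
    then have "distr M borel (\<lambda>\<omega>. g \<omega> $ j) = std_normal_distribution"
      by (simp cong: distr_cong)
    then have "char (distr M borel (\<lambda>\<omega>. g \<omega> $ j)) (w $ j) = exp (- (w $ j)\<^sup>2 / 2)"
      by (simp only: char_std_normal_distribution)
    then show ?thesis
      by (simp add: char_def integral_distr)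
  qed
  have "(CLINT \<omega>|M. iexp (g \<omega> \<bullet> w)) = char (distr M borel (\<lambda>\<omega>. \<Sum>j\<in>UNIV. w $ j * g \<omega> $ j)) 1"
    by (simp add: char_def integral_distr inner_vec_def mult.commute)
  also have "\<dots> = (\<Prod>j\<in>UNIV. char (distr M borel (\<lambda>\<omega>. w $ j * g \<omega> $ j)) 1)"
    by (rule char_distr_sum[OF standard_normal_vector_weighted_indep[OF g]])
  also have "\<dots> = (\<Prod>j\<in>UNIV. complex_of_real (exp (- (w $ j)\<^sup>2 / 2)))"
    using coord by (intro prod.cong) (simp_all add: char_def integral_distr)
  also have "\<dots> = complex_of_real (exp (\<Sum>j\<in>UNIV. - (w $ j)\<^sup>2 / 2))"
    by (simp add: exp_sum)
  also have "(\<Sum>j\<in>UNIV. - (w $ j)\<^sup>2 / 2) = - (norm w)\<^sup>2 / 2"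
    unfolding power2_norm_eq_inner inner_vec_def
    by (simp add: power2_eq_square sum_negf flip: sum_divide_distrib)
  finally show ?thesis .
qed

text \<open>
  By the formula for the characteristic function of \<open>g\<close>, factorization amounts to
  \<open>|s v + t w|\<^sup>2 = |s v|\<^sup>2 + |t w|\<^sup>2\<close>, which is the theorem of Pythagoras.
\<close>
lemma (in prob_space) standard_normal_vector_orthogonal_indep:
  fixes g :: "'a \<Rightarrow> real ^ 'n"
  assumes g: "standard_normal_vector M g" and orth: "v \<bullet> w = 0"
  shows "indep_var borel (\<lambda>\<omega>. g \<omega> \<bullet> v) borel (\<lambda>\<omega>. g \<omega> \<bullet> w)"
proof (rule indep_var_if_char_factorizes)
  note [measurable] = standard_normal_vector_measurable[OF g]
  show "random_variable borel (\<lambda>\<omega>. g \<omega> \<bullet> v)" "random_variable borel (\<lambda>\<omega>. g \<omega> \<bullet> w)"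
    by simp_all
  fix s t
  have char: "char (distr M borel (\<lambda>\<omega>. g \<omega> \<bullet> u)) r = exp (- (norm (r *\<^sub>R u))\<^sup>2 / 2)" for u r
    using standard_normal_vector_char[OF g, of "r *\<^sub>R u"] by (simp add: char_def integral_distr)
  have "(norm (s *\<^sub>R v + t *\<^sub>R w))\<^sup>2 = (norm (s *\<^sub>R v))\<^sup>2 + (norm (t *\<^sub>R w))\<^sup>2"
    using orth by (intro norm_add_Pythagorean) (simp add: orthogonal_def)
  then show "(CLINT \<omega>|M. iexp (s * (g \<omega> \<bullet> v) + t * (g \<omega> \<bullet> w))) =
      char (distr M borel (\<lambda>\<omega>. g \<omega> \<bullet> v)) s * char (distr M borel (\<lambda>\<omega>. g \<omega> \<bullet> w)) t"
    using standard_normal_vector_char[OF g, of "s *\<^sub>R v + t *\<^sub>R w"]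
    unfolding char by (simp add: inner_add_right exp_add[symmetric] add_divide_distrib
        diff_divide_distrib del: of_real_exp flip: of_real_mult)
qed

text \<open>
  The projection \<open>\<langle>g, w\<rangle>\<close> is the sum of the independent centered variables \<open>w\<^sub>j g\<^sub>j\<close> with variances
  \<open>w\<^sub>j\<^sup>2\<close>.
\<close>
lemma (in prob_space) standard_normal_vector_moments:
  fixes g :: "'a \<Rightarrow> real ^ 'n"
  assumes g: "standard_normal_vector M g"
  shows standard_normal_vector_inner_integrable: "integrable M (\<lambda>\<omega>. g \<omega> \<bullet> w)"
    and standard_normal_vector_inner_expectation: "expectation (\<lambda>\<omega>. g \<omega> \<bullet> w) = 0"
    and standard_normal_vector_inner_square_integrable: "integrable M (\<lambda>\<omega>. (g \<omega> \<bullet> w)\<^sup>2)"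
    and standard_normal_vector_inner_square_expectation:
      "expectation (\<lambda>\<omega>. (g \<omega> \<bullet> w)\<^sup>2) = (norm w)\<^sup>2"
proof -
  have D: "distributed M lborel (\<lambda>\<omega>. g \<omega> $ j) std_normal_density" for j
    using g by (simp add: standard_normal_vector_def)
  have int: "integrable M (\<lambda>\<omega>. g \<omega> $ j)" for j
    using distributed_integrable_var[OF D] integrable_std_normal_moment[of 1] by simp
  have zero: "expectation (\<lambda>\<omega>. g \<omega> $ j) = 0" for j
    by (rule standard_normal_distributed_expectation[OF D])
  have int2: "integrable M (\<lambda>\<omega>. (g \<omega> $ j)\<^sup>2)" for j
    using distributed_integrable[OF D, of "\<lambda>r. r\<^sup>2"] integrable_std_normal_moment[of 2] by simp
  have one: "expectation (\<lambda>\<omega>. (g \<omega> $ j)\<^sup>2) = 1" for j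
    using standard_normal_distributed_variance[OF D, of j] by (simp add: zero)
  have inner: "g \<omega> \<bullet> w = (\<Sum>j\<in>UNIV. w $ j * g \<omega> $ j)" for \<omega>
    by (simp add: inner_vec_def mult.commute)
  have norm_sq: "(norm w)\<^sup>2 = (\<Sum>j\<in>UNIV. (w $ j)\<^sup>2)"
    by (simp add: power2_norm_eq_inner inner_vec_def) (simp add: power2_eq_square)
  show "integrable M (\<lambda>\<omega>. g \<omega> \<bullet> w)" "expectation (\<lambda>\<omega>. g \<omega> \<bullet> w) = 0"
    unfolding inner using int zero by simp_all
  show "integrable M (\<lambda>\<omega>. (g \<omega> \<bullet> w)\<^sup>2)" "expectation (\<lambda>\<omega>. (g \<omega> \<bullet> w)\<^sup>2) = (norm w)\<^sup>2"
    unfolding inner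
    using square_sum_indep_centered[OF _ standard_normal_vector_weighted_indep[OF g, of w]]
    by (simp_all add: power_mult_distrib int2 one zero norm_sq)
qed

section \<open>Conditional independence from an independent conditioner\<close>

text \<open>
  Let \<open>X\<close> and \<open>Y\<close> be conditionally independent given \<open>Z\<close>, and let \<open>h Y\<close> be independent of \<open>Z\<close>. The
  conditional probability given \<open>Z\<close> of an event about \<open>h Y\<close> is then almost surely the constant unconditional
  one, so integrating the conditional product formula yields the unconditional one.
\<close>
lemma (in prob_space) cond_indep_given_indep:
  assumes ci: "cond_indep_given M U Z S X T Y"
    and h[measurable]: "h \<in> measurable T N"
    and ind: "indep_var U Z N (\<lambda>\<omega>. h (Y \<omega>))"
  shows "indep_var S X N (\<lambda>\<omega>. h (Y \<omega>))"
proof (rule indep_varI_prob)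
  have Z[measurable]: "random_variable U Z" and X[measurable]: "random_variable S X"
    and Y[measurable]: "random_variable T Y"
    using ci by (auto simp: cond_indep_given_def)
  show "random_variable S X" "random_variable N (\<lambda>\<omega>. h (Y \<omega>))"
    by simp_all
  fix A C assume A[measurable]: "A \<in> sets S" and C[measurable]: "C \<in> sets N"
  define F where "F = vimage_algebra (space M) Z U"
  define D where "D = X -` A \<inter> space M"
  define E where "E = (\<lambda>\<omega>. h (Y \<omega>)) -` C \<inter> space M"
  have [measurable]: "D \<in> events" "E \<in> events"
    unfolding D_def E_def by measurable
  have sets_F: "sets F = {Z -` B \<inter> space M | B. B \<in> sets U}"
    unfolding F_def using measurable_space[OF Z] by (intro sets_vimage_algebra2) auto
  have "subalgebra M F"
    unfolding subalgebra_def using measurable_sets[OF Z] by (auto simp: sets_F) (simp_all add: F_def)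
  then interpret finite_measure_subalgebra M F
    by unfold_locales
  have int_ind: "integrable M (indicator G :: 'a \<Rightarrow> real)" if "G \<in> events" for G
    using that by (intro integrable_real_indicator) (auto simp: less_top[symmetric])
  have cond_E: "AE \<omega> in M. real_cond_exp M F (indicator E) \<omega> = prob E"
  proof (rule real_cond_exp_charact)
    fix G assume "G \<in> sets F"
    then obtain B where B[measurable]: "B \<in> sets U" and G: "G = Z -` B \<inter> space M"
      by (auto simp: sets_F)
    have [measurable]: "G \<in> events"
      unfolding G by measurable
    have "prob (G \<inter> E) = prob G * prob E"
      using indep_varD[OF ind B C] unfolding G E_def
      by (simp add: vimage_Times comp_def Int_ac)
    then show "(\<integral>\<omega>\<in>G. indicator E \<omega> \<partial>M) = (\<integral>\<omega>\<in>G. prob E \<partial>M)"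
      by (simp add: set_lebesgue_integral_def indicator_inter_arith[symmetric])
  qed (simp_all add: int_ind)
  have E_vimage: "E = Y -` (h -` C \<inter> space T) \<inter> space M"
    unfolding E_def using measurable_space[OF Y] by auto
  have "AE \<omega> in M. real_cond_exp M F (indicator (D \<inter> E)) \<omega> =
      real_cond_exp M F (indicator D) \<omega> * real_cond_exp M F (indicator E) \<omega>"
    using ci A measurable_sets[OF h C] unfolding cond_indep_given_def F_def D_def E_vimage by blast
  with cond_E have *: "AE \<omega> in M. real_cond_exp M F (indicator (D \<inter> E)) \<omega> =
      real_cond_exp M F (indicator D) \<omega> * prob E"
    by eventually_elim simp
  have "prob (D \<inter> E) = expectation (real_cond_exp M F (indicator (D \<inter> E)))"
    by (subst real_cond_exp_int(2)) (auto intro!: int_ind)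
  also have "\<dots> = expectation (\<lambda>\<omega>. real_cond_exp M F (indicator D) \<omega> * prob E)"
    by (intro integral_cong_AE *) auto
  also have "\<dots> = prob D * prob E"
    using real_cond_exp_int(2)[OF int_ind[of D]] by simp
  finally show "prob (X -` A \<inter> space M \<inter> ((\<lambda>\<omega>. h (Y \<omega>)) -` C \<inter> space M)) =
      prob (X -` A \<inter> space M) * prob ((\<lambda>\<omega>. h (Y \<omega>)) -` C \<inter> space M)"
    by (simp add: D_def E_def)
qed

section \<open>Moments of a single observation\<close>

text \<open>
  The response \<open>y\<close> is independent of \<open>\<langle>a, v\<rangle>\<close>: conditionally on \<open>\<langle>a, x\<rangle>\<close> it is independent of \<open>a\<close>,
  and \<open>\<langle>a, v\<rangle>\<close> is independent of \<open>\<langle>a, x\<rangle>\<close>. So the first two moments of the product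
  factorize.
\<close>
lemma (in prob_space) single_index_orthogonal:
  fixes a :: "'a \<Rightarrow> real ^ 'n" and y :: "'a \<Rightarrow> real"
  assumes a: "standard_normal_vector M a"
    and ci: "cond_indep_given M borel (\<lambda>\<omega>. a \<omega> \<bullet> x) borel y borel a"
    and y2: "integrable M (\<lambda>\<omega>. (y \<omega>)\<^sup>2)"
    and orth: "x \<bullet> v = 0"
  shows "integrable M (\<lambda>\<omega>. y \<omega> * (a \<omega> \<bullet> v))"
    and "expectation (\<lambda>\<omega>. y \<omega> * (a \<omega> \<bullet> v)) = 0"
    and "integrable M (\<lambda>\<omega>. (y \<omega> * (a \<omega> \<bullet> v))\<^sup>2)"
    and "expectation (\<lambda>\<omega>. (y \<omega> * (a \<omega> \<bullet> v))\<^sup>2) = expectation (\<lambda>\<omega>. (y \<omega>)\<^sup>2) * (norm v)\<^sup>2"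
proof -
  have y[measurable]: "random_variable borel y"
    using ci by (simp add: cond_indep_given_def)
  have int_y: "integrable M y"
    using square_integrable_imp_integrable[OF y] y2 by simp
  have iv: "indep_var borel y borel (\<lambda>\<omega>. a \<omega> \<bullet> v)"
    using standard_normal_vector_orthogonal_indep[OF a orth]
    by (intro cond_indep_given_indep[OF ci]) auto
  have iv2: "indep_var borel (\<lambda>\<omega>. (y \<omega>)\<^sup>2) borel (\<lambda>\<omega>. (a \<omega> \<bullet> v)\<^sup>2)"
    using indep_var_compose[OF iv, of "\<lambda>r. r\<^sup>2" borel "\<lambda>r. r\<^sup>2" borel] by (simp add: comp_def)
  note m = standard_normal_vector_moments[OF a, of v]
  show "integrable M (\<lambda>\<omega>. y \<omega> * (a \<omega> \<bullet> v))" "expectation (\<lambda>\<omega>. y \<omega> * (a \<omega> \<bullet> v)) = 0"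
    using indep_var_integrable[OF iv int_y m(1)] indep_var_lebesgue_integral[OF iv int_y m(1)] m(2)
    by simp_all
  show "integrable M (\<lambda>\<omega>. (y \<omega> * (a \<omega> \<bullet> v))\<^sup>2)"
    "expectation (\<lambda>\<omega>. (y \<omega> * (a \<omega> \<bullet> v))\<^sup>2) = expectation (\<lambda>\<omega>. (y \<omega>)\<^sup>2) * (norm v)\<^sup>2"
    using indep_var_integrable[OF iv2 y2 m(3)] indep_var_lebesgue_integral[OF iv2 y2 m(3)] m(4)
    by (simp_all add: power_mult_distrib)
qed

text \<open>
  Instead of an orthonormal basis of the hyperplane orthogonal to \<open>u\<close>, the proof uses the projections
  \<open>v\<^sub>j = e\<^sub>j - u\<^sub>j u\<close> of the \<open>n\<close> standard basis vectors \<open>e\<^sub>j\<close> onto it: \<open>\<langle>a, v\<^sub>j\<rangle>\<close> is the \<open>j\<close>-th coordinate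
  of the projection of \<open>a\<close>. Their squared norms \<open>1 - u\<^sub>j\<^sup>2\<close> add up to \<open>n - 1\<close>, which is
  where that factor comes from.
\<close>
lemma (in prob_space) single_index_moments:
  fixes a :: "'a \<Rightarrow> real ^ 'n" and y :: "'a \<Rightarrow> real" and x u :: "real ^ 'n"
  assumes a: "standard_normal_vector M a"
    and ci: "cond_indep_given M borel (\<lambda>\<omega>. a \<omega> \<bullet> x) borel y borel a"
    and x: "x \<noteq> 0" and u: "u = x /\<^sub>R norm x"
    and int: "integrable M (\<lambda>\<omega>. y \<omega> * (a \<omega> \<bullet> u))"
    and mu: "\<mu> = expectation (\<lambda>\<omega>. y \<omega> * (a \<omega> \<bullet> u))"
    and sq: "integrable M (\<lambda>\<omega>. (y \<omega> * (a \<omega> \<bullet> u) - \<mu>)\<^sup>2)"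
    and y2: "integrable M (\<lambda>\<omega>. (y \<omega>)\<^sup>2)"
  shows "integrable M (\<lambda>\<omega>. y \<omega> *\<^sub>R a \<omega>)"
    and "expectation (\<lambda>\<omega>. y \<omega> *\<^sub>R a \<omega>) = \<mu> *\<^sub>R u"
    and "integrable M (\<lambda>\<omega>. (norm (y \<omega> *\<^sub>R a \<omega> - \<mu> *\<^sub>R u))\<^sup>2)"
    and "expectation (\<lambda>\<omega>. (norm (y \<omega> *\<^sub>R a \<omega> - \<mu> *\<^sub>R u))\<^sup>2) =
      variance (\<lambda>\<omega>. y \<omega> * (a \<omega> \<bullet> u)) + expectation (\<lambda>\<omega>. (y \<omega>)\<^sup>2) * (real CARD('n) - 1)"
proof -
  define v where "v j = axis j 1 - (u $ j) *\<^sub>R u" for j :: 'n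
  have uu: "u \<bullet> u = 1"
    using x by (simp add: u dot_square_norm power2_eq_square)
  have xu: "x = norm x *\<^sub>R u"
    using x by (simp add: u)
  have uv: "u \<bullet> v j = 0" for j
    using uu by (simp add: v_def inner_diff_right inner_axis)
  have xv: "x \<bullet> v j = 0" for j
    by (subst xu) (simp add: uv)
  note orth = single_index_orthogonal[OF a ci y2 xv]
  have sum_u: "(\<Sum>j\<in>UNIV. (u $ j)\<^sup>2) = 1"
    using uu by (simp add: inner_vec_def power2_eq_square)
  have norm_v: "(norm (v j))\<^sup>2 = 1 - (u $ j)\<^sup>2" for j
    unfolding power2_norm_eq_inner using uu
    by (simp add: v_def inner_diff_left inner_diff_right inner_axis inner_axis' power2_eq_square)
  have coord: "a \<omega> $ j = (a \<omega> \<bullet> u) * u $ j + a \<omega> \<bullet> v j" for \<omega> j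
    by (simp add: v_def inner_diff_right inner_axis)
  have mean: "has_bochner_integral M (\<lambda>\<omega>. y \<omega> * a \<omega> $ j) (\<mu> * u $ j)" for j
  proof -
    have "has_bochner_integral M (\<lambda>\<omega>. y \<omega> * (a \<omega> \<bullet> u) * u $ j + y \<omega> * (a \<omega> \<bullet> v j)) (\<mu> * u $ j + 0)"
      using int orth(1,2)[of j]
      by (intro has_bochner_integral_add has_bochner_integral_mult_left)
         (simp_all add: has_bochner_integral_iff mu)
    then show ?thesis
      by (simp add: coord algebra_simps)
  qed
  have vec: "z = (\<Sum>j\<in>UNIV. (z $ j) *\<^sub>R axis j 1)" for z :: "real ^ 'n"
    by (simp add: vec_eq_iff axis_def if_distrib sum.delta cong: if_cong)
  have "has_bochner_integral M (\<lambda>\<omega>. \<Sum>j\<in>UNIV. (y \<omega> * a \<omega> $ j) *\<^sub>R axis j (1::real))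
      (\<Sum>j\<in>UNIV. (\<mu> * u $ j) *\<^sub>R axis j 1)"
    by (intro has_bochner_integral_sum has_bochner_integral_scaleR_left mean)
  then have "has_bochner_integral M (\<lambda>\<omega>. y \<omega> *\<^sub>R a \<omega>) (\<mu> *\<^sub>R u)"
    by (subst vec, subst (2) vec) simp
  then show "integrable M (\<lambda>\<omega>. y \<omega> *\<^sub>R a \<omega>)" "expectation (\<lambda>\<omega>. y \<omega> *\<^sub>R a \<omega>) = \<mu> *\<^sub>R u"
    by (simp_all add: has_bochner_integral_iff)
  have split: "(norm (y \<omega> *\<^sub>R a \<omega> - \<mu> *\<^sub>R u))\<^sup>2 =
      (y \<omega> * (a \<omega> \<bullet> u) - \<mu>)\<^sup>2 + (\<Sum>j\<in>UNIV. (y \<omega> * (a \<omega> \<bullet> v j))\<^sup>2)" for \<omega>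
  proof -
    define p where "p = (\<chi> j. y \<omega> * (a \<omega> \<bullet> v j))"
    define c where "c = y \<omega> * (a \<omega> \<bullet> u) - \<mu>"
    \<comment> \<open>The coordinates of \<open>p\<close> assemble to the part of \<open>y a\<close> orthogonal to \<open>u\<close>.\<close>
    have p: "p = y \<omega> *\<^sub>R (a \<omega> - (a \<omega> \<bullet> u) *\<^sub>R u)"
      by (simp add: p_def vec_eq_iff coord)
    have "y \<omega> *\<^sub>R a \<omega> - \<mu> *\<^sub>R u = c *\<^sub>R u + p"
      by (simp add: p c_def algebra_simps)
    moreover have "orthogonal (c *\<^sub>R u) p"
      by (simp add: p orthogonal_def inner_diff_right uu inner_commute)
    ultimately have "(norm (y \<omega> *\<^sub>R a \<omega> - \<mu> *\<^sub>R u))\<^sup>2 = (norm (c *\<^sub>R u))\<^sup>2 + (norm p)\<^sup>2"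
      by (simp only: norm_add_Pythagorean)
    moreover have "(norm (c *\<^sub>R u))\<^sup>2 = c\<^sup>2"
      using uu by (simp add: power_mult_distrib power2_norm_eq_inner)
    moreover have "(norm p)\<^sup>2 = (\<Sum>j\<in>UNIV. (y \<omega> * (a \<omega> \<bullet> v j))\<^sup>2)"
      unfolding power2_norm_eq_inner inner_vec_def[of p] by (simp add: p_def power2_eq_square)
    ultimately show ?thesis
      by (simp add: c_def)
  qed
  show "integrable M (\<lambda>\<omega>. (norm (y \<omega> *\<^sub>R a \<omega> - \<mu> *\<^sub>R u))\<^sup>2)"
    unfolding split using sq orth(3) by simp
  have "(\<Sum>j\<in>UNIV. expectation (\<lambda>\<omega>. (y \<omega>)\<^sup>2) * (norm (v j))\<^sup>2) =
      expectation (\<lambda>\<omega>. (y \<omega>)\<^sup>2) * (real CARD('n) - 1)"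
    by (simp add: norm_v sum_subtractf sum_u flip: sum_distrib_left)
  then show "expectation (\<lambda>\<omega>. (norm (y \<omega> *\<^sub>R a \<omega> - \<mu> *\<^sub>R u))\<^sup>2) =
      variance (\<lambda>\<omega>. y \<omega> * (a \<omega> \<bullet> u)) + expectation (\<lambda>\<omega>. (y \<omega>)\<^sup>2) * (real CARD('n) - 1)"
    unfolding split using sq orth(3,4) by (simp add: mu)
qed

section \<open>Mean and mean square error of the linear estimator\<close>

theorem proposition1p1:
  fixes M :: "'w measure"
    and m :: nat
    and x xbar :: "real ^ 'n"
    and a :: "nat \<Rightarrow> 'w \<Rightarrow> real ^ 'n"
    and y :: "nat \<Rightarrow> 'w \<Rightarrow> real"
    and \<mu> sigma_sq eta_sq :: real
  assumes "prob_space M"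
    and "m \<ge> 1"
    and "x \<noteq> 0"
    and "xbar = x /\<^sub>R norm x"
    and "\<And>i. i \<in> {1..m} \<Longrightarrow> standard_normal_vector M (a i)"
    and "prob_space.indep_vars M (\<lambda>_. borel) a {1..m}"
    and "\<And>i. i \<in> {1..m} \<Longrightarrow> y i \<in> borel_measurable M"
    and "prob_space.indep_vars M (\<lambda>_. borel \<Otimes>\<^sub>M borel) (\<lambda>i \<omega>. (a i \<omega>, y i \<omega>)) {1..m}"
    and "\<And>i j. i \<in> {1..m} \<Longrightarrow> j \<in> {1..m} \<Longrightarrow>
           distr M (borel \<Otimes>\<^sub>M borel) (\<lambda>\<omega>. (a i \<omega>, y i \<omega>)) =
           distr M (borel \<Otimes>\<^sub>M borel) (\<lambda>\<omega>. (a j \<omega>, y j \<omega>))"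
    and "\<And>i. i \<in> {1..m} \<Longrightarrow>
           cond_indep_given M borel (\<lambda>\<omega>. a i \<omega> \<bullet> x) borel (y i) borel (a i)"
    and "integrable M (\<lambda>\<omega>. y 1 \<omega> * (a 1 \<omega> \<bullet> xbar))"
    and "\<mu> = prob_space.expectation M (\<lambda>\<omega>. y 1 \<omega> * (a 1 \<omega> \<bullet> xbar))"
    and "integrable M (\<lambda>\<omega>. (y 1 \<omega> * (a 1 \<omega> \<bullet> xbar) - \<mu>)\<^sup>2)"
    and "sigma_sq = prob_space.variance M (\<lambda>\<omega>. y 1 \<omega> * (a 1 \<omega> \<bullet> xbar))"
    and "integrable M (\<lambda>\<omega>. (y 1 \<omega>)\<^sup>2)"
    and "eta_sq = prob_space.expectation M (\<lambda>\<omega>. (y 1 \<omega>)\<^sup>2)"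
  shows "(integrable M (linear_estimator m a y) \<and>
          prob_space.expectation M (linear_estimator m a y) = \<mu> *\<^sub>R xbar) \<and>
         (integrable M (\<lambda>\<omega>. (norm (linear_estimator m a y \<omega> - \<mu> *\<^sub>R xbar))\<^sup>2) \<and>
          prob_space.expectation M (\<lambda>\<omega>. (norm (linear_estimator m a y \<omega> - \<mu> *\<^sub>R xbar))\<^sup>2) =
            1 / real m * (sigma_sq + eta_sq * (real CARD('n) - 1)))"
proof -
  interpret prob_space M by fact
  have one: "1 \<in> {1..m}" using \<open>m \<ge> 1\<close> by simp
  note first = single_index_moments[OF assms(5)[OF one] assms(10)[OF one] assms(3,4,11,12,13,15),
      folded assms(14,16)]
  have pair: "(\<lambda>\<omega>. (a i \<omega>, y i \<omega>)) \<in> measurable M (borel \<Otimes>\<^sub>M borel)" if "i \<in> {1..m}" for i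
    using standard_normal_vector_borel_measurable[OF assms(5)[OF that]] assms(7)[OF that] by measurable
  \<comment> \<open>All observations have the law of the first, so a moment computed for it holds for each of them.\<close>
  have transfer: "has_bochner_integral M (\<lambda>\<omega>. f (a i \<omega>, y i \<omega>)) r"
    if i: "i \<in> {1..m}" and f[measurable]: "f \<in> borel_measurable (borel \<Otimes>\<^sub>M borel)"
      and "has_bochner_integral M (\<lambda>\<omega>. f (a 1 \<omega>, y 1 \<omega>)) r"
    for i r and f :: "(real ^ 'n) \<times> real \<Rightarrow> 'c::{banach, second_countable_topology}"
    using that(3) integrable_distr_eq[OF pair[OF i] f] integrable_distr_eq[OF pair[OF one] f]
      integral_distr[OF pair[OF i] f] integral_distr[OF pair[OF one] f] assms(9)[OF i one]
    by (simp add: has_bochner_integral_iff)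
  define X where "X i \<omega> = y i \<omega> *\<^sub>R a i \<omega> - \<mu> *\<^sub>R xbar" for i \<omega>
  define s where "s = sigma_sq + eta_sq * (real CARD('n) - 1)"
  have "has_bochner_integral M (X 1) 0"
    using first(1,2) by (simp add: has_bochner_integral_iff X_def[abs_def] prob_space)
  then have X: "has_bochner_integral M (X i) 0" if "i \<in> {1..m}" for i
    using transfer[OF that, of "\<lambda>(b, z). z *\<^sub>R b - \<mu> *\<^sub>R xbar" 0] by (simp add: X_def[abs_def])
  have "has_bochner_integral M (\<lambda>\<omega>. (norm (X 1 \<omega>))\<^sup>2) s"
    using first(3,4) by (simp add: has_bochner_integral_iff X_def s_def)
  then have X2: "has_bochner_integral M (\<lambda>\<omega>. (norm (X i \<omega>))\<^sup>2) s" if "i \<in> {1..m}" for i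
    using transfer[OF that, of "\<lambda>(b, z). (norm (z *\<^sub>R b - \<mu> *\<^sub>R xbar))\<^sup>2" s] by (simp add: X_def)
  have "indep_vars (\<lambda>_. borel) X {1..m}"
    using indep_vars_compose2[OF assms(8), of "\<lambda>_ (b, z). z *\<^sub>R b - \<mu> *\<^sub>R xbar" "\<lambda>_. borel"]
    by (simp add: X_def[abs_def])
  note sum = norm_square_sum_indep_centered[OF finite_atLeastAtMost this]
  have est: "linear_estimator m a y \<omega> = \<mu> *\<^sub>R xbar + (1 / real m) *\<^sub>R (\<Sum>i = 1..m. X i \<omega>)" for \<omega>
    using \<open>m \<ge> 1\<close>
    by (simp add: linear_estimator_def X_def sum_subtractf scaleR_diff_right scaleR_sum_left
        sum_constant_scaleR del: sum_constant)
  have "has_bochner_integral M (linear_estimator m a y)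
      (\<mu> *\<^sub>R xbar + (1 / real m) *\<^sub>R (\<Sum>i = 1..m. 0))"
    unfolding est[abs_def] using X
    by (intro has_bochner_integral_add has_bochner_integral_scaleR_right has_bochner_integral_sum)
       (auto simp: has_bochner_integral_iff prob_space)
  moreover have "has_bochner_integral M (\<lambda>\<omega>. (norm (linear_estimator m a y \<omega> - \<mu> *\<^sub>R xbar))\<^sup>2)
      ((1 / real m)\<^sup>2 * (\<Sum>i = 1..m. s))"
  proof -
    have "has_bochner_integral M (\<lambda>\<omega>. (norm (\<Sum>i = 1..m. X i \<omega>))\<^sup>2) (\<Sum>i = 1..m. s)"
      using sum X X2 by (simp add: has_bochner_integral_iff)
    then have "has_bochner_integral M (\<lambda>\<omega>. (1 / real m)\<^sup>2 * (norm (\<Sum>i = 1..m. X i \<omega>))\<^sup>2)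
        ((1 / real m)\<^sup>2 * (\<Sum>i = 1..m. s))"
      by (intro has_bochner_integral_mult_right)
    then show ?thesis
      by (simp add: est power_mult_distrib power_divide)
  qed
  moreover have "(1 / real m)\<^sup>2 * (\<Sum>i = 1..m. s) = 1 / real m * s"
    using \<open>m \<ge> 1\<close> by (simp add: power2_eq_square)
  ultimately show ?thesis
    by (simp add: has_bochner_integral_iff s_def)
qed

end
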